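(* Let $d\in\mathbb{N}$ and $p\in\mathbb{N}$. For $k=1,\ldots,d$ let $A_k=\operatorname{diag}[a_k(n)]_{n=1}^\infty$ be bounded diagonal operators on $\mathcal{H}$ such that $a_k(pn)=a_k(n)$ for all $n\in\mathbb{N}$. Let $\{B_j\}_{j=2}^\infty$ be another sequence of diagonal operators $B_j=\operatorname{diag}[b_j(n)]_{n=1}^\infty$ (with $b_j(n)\in\mathbb{C}$). Assume that $$\sum_{j=2}^\infty\sup_{n\in\mathbb{N}}|b_j(n)|<\inf_{z\in\mathbb{D},\,n\in\mathbb{N}}\left|1+\sum_{k=1}^da_k(n)z^k\right|.$$ Then the operators $B_j$ are bounded and the operator $$T=I+\sum_{k=1}^dA_kM_p^k+\sum_{j=2}^\infty M_jB_j$$ is bounded and invertible on $\mathcal{H}$.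
   Context: $\mathcal{H}$ is a separable (infinite-dimensional) complex Hilbert space with a fixed orthonormal basis $\{e_n\}_{n=1}^\infty$, $\mathbb{N}=\{1,2,\ldots\}$, $\mathbb{D}=\{z\in\mathbb{C}:|z|<1\}$. For $j\in\mathbb{N}$, $M_j:\mathcal{H}\to\mathcal{H}$ is the linear isometry with $M_je_n=e_{nj}$. For a scalar sequence $\{a(n)\}$, $\operatorname{diag}[a(n)]_{n=1}^\infty$ is the diagonal operator with $e_n\mapsto a(n)e_n$; it is bounded exactly when $\sup_n|a(n)|<\infty$, with norm equal to this supremum. Invertible means having a bounded inverse on $\mathcal{H}$. *)

theory Defs
  imports "HOL-Analysis.Analysis"
begin

text \<open>Complex Hilbert spaces: a real Banach space carrying a compatible complex scalar
  multiplication and a complex inner product (linear in the first argument) that induces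
  the given norm.  Positive definiteness of the inner product follows from the last axiom.\<close>

class complex_hilbert = banach +
  fixes scaleC :: "complex \<Rightarrow> 'a \<Rightarrow> 'a" (infixr "*\<^sub>C" 75)
    and cinner :: "'a \<Rightarrow> 'a \<Rightarrow> complex"
  assumes scaleC_add_right: "c *\<^sub>C (x + y) = c *\<^sub>C x + c *\<^sub>C y"
    and scaleC_add_left: "(c + d) *\<^sub>C x = c *\<^sub>C x + d *\<^sub>C x"
    and scaleC_scaleC: "c *\<^sub>C (d *\<^sub>C x) = (c * d) *\<^sub>C x"
    and scaleC_of_real: "complex_of_real r *\<^sub>C x = r *\<^sub>R x"
    and cinner_add_left: "cinner (x + y) z = cinner x z + cinner y z"
    and cinner_scaleC_left: "cinner (c *\<^sub>C x) y = c * cinner x y"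
    and cinner_commute: "cinner x y = cnj (cinner y x)"
    and cinner_self: "cinner x x = complex_of_real ((norm x)\<^sup>2)"

global_interpretation complex_vector:
  vector_space "scaleC :: complex \<Rightarrow> 'a \<Rightarrow> 'a::complex_hilbert"
  defines cspan = complex_vector.span
proof
  fix x :: 'a
  show "1 *\<^sub>C x = x"
    using scaleC_of_real[of 1 x] by simp
qed (simp_all add: scaleC_add_right scaleC_add_left scaleC_scaleC)

abbreviation clinear :: "('a::complex_hilbert \<Rightarrow> 'a) \<Rightarrow> bool"
  where "clinear \<equiv> Vector_Spaces.linear scaleC scaleC"

definition bounded_clinear :: "('a::complex_hilbert \<Rightarrow> 'a) \<Rightarrow> bool"
  where "bounded_clinear f \<longleftrightarrow> clinear f \<and> (\<exists>K. \<forall>x. norm (f x) \<le> K * norm x)"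

definition clinear_isometry :: "('a::complex_hilbert \<Rightarrow> 'a) \<Rightarrow> bool"
  where "clinear_isometry f \<longleftrightarrow> clinear f \<and> (\<forall>x. norm (f x) = norm x)"

definition boundedly_invertible :: "('a::complex_hilbert \<Rightarrow> 'a) \<Rightarrow> bool"
  where "boundedly_invertible f \<longleftrightarrow>
    (\<exists>g. bounded_clinear g \<and> (\<forall>x. g (f x) = x) \<and> (\<forall>x. f (g x) = x))"

text \<open>Bases are indexed by the positive integers; the value \<open>e 0\<close> is irrelevant throughout.\<close>

definition orthonormal_basis :: "(nat \<Rightarrow> 'a::complex_hilbert) \<Rightarrow> bool"
  where "orthonormal_basis e \<longleftrightarrow>
    (\<forall>m\<ge>1. \<forall>n\<ge>1. cinner (e m) (e n) = (if m = n then 1 else 0)) \<and>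
    closure (cspan (e ` {1..})) = UNIV"

text \<open>The diagonal operator \<open>e n \<mapsto> a n *\<^sub>C e n\<close> for an arbitrary, possibly unbounded, scalar
  sequence: it is given by the expansion with respect to \<open>e\<close>, on the maximal domain on which
  this expansion converges.  Off the domain, \<open>diag e a x\<close> is a dummy value, so boundedness
  on the whole space must include the condition that the domain is everything.\<close>

definition diag_domain :: "(nat \<Rightarrow> 'a::complex_hilbert) \<Rightarrow> (nat \<Rightarrow> complex) \<Rightarrow> 'a set"
  where "diag_domain e a = {x. (\<lambda>n. (a n * cinner x (e n)) *\<^sub>C e n) summable_on {1..}}"

definition diag :: "(nat \<Rightarrow> 'a::complex_hilbert) \<Rightarrow> (nat \<Rightarrow> complex) \<Rightarrow> 'a \<Rightarrow> 'a"
  where "diag e a x = (\<Sum>\<^sub>\<infinity>n\<in>{1..}. (a n * cinner x (e n)) *\<^sub>C e n)"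

definition bounded_diag :: "(nat \<Rightarrow> 'a::complex_hilbert) \<Rightarrow> (nat \<Rightarrow> complex) \<Rightarrow> bool"
  where "bounded_diag e a \<longleftrightarrow> diag_domain e a = UNIV \<and> bounded_clinear (diag e a)"

end

theory Submission
  imports Defs
begin

text \<open>Put \<open>V = M p\<close>.  Periodicity makes \<open>V\<close> commute with the diagonal operators \<open>A k\<close>, so
  on an approximate eigenvector of the isometry \<open>V\<close> for a unimodular eigenvalue \<open>\<omega>\<close> the operator
  \<open>Q = I + \<Sum> A k V^k\<close> acts nearly as the diagonal operator with entries
  \<open>1 + \<Sum> a k n \<omega>^k\<close>.  Averaging over all \<open>N\<close>-th roots of unity \<open>\<omega>\<close> and letting \<open>N\<close> tend to
  infinity shows that \<open>Q\<close> is bounded below by the infimum \<open>c\<close> of the symbol.  The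
  perturbation \<open>R = \<Sum> M j B j\<close> has norm at most \<open>S < c\<close>, so \<open>I + \<Sum> r^k A k V^k + r R\<close> is bounded
  below by \<open>c - S\<close> for every \<open>r\<close> in \<open>[0, 1]\<close>; by the method of continuity surjectivity
  propagates from \<open>r = 0\<close> to \<open>r = 1\<close>.\<close>

section \<open>Complex inner products and bounded operators\<close>

lemma cinner_add_right: "cinner x (y + z) = cinner x y + cinner x (z::'a::complex_hilbert)"
  by (metis cinner_add_left cinner_commute complex_cnj_add)

lemma cinner_scaleC_right: "cinner x (c *\<^sub>C y) = cnj c * cinner x (y::'a::complex_hilbert)"
  by (metis cinner_commute cinner_scaleC_left complex_cnj_mult)

lemma cinner_zero_left [simp]: "cinner 0 (y::'a::complex_hilbert) = 0"
  by (metis add_cancel_right_left cinner_add_left)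

lemma cinner_zero_right [simp]: "cinner y (0::'a::complex_hilbert) = 0"
  by (metis add_cancel_right_left cinner_add_right)

lemma cinner_diff_left: "cinner (x - y) z = cinner x z - cinner y (z::'a::complex_hilbert)"
  by (metis add_diff_cancel cinner_add_left diff_add_cancel)

lemma cinner_diff_right: "cinner z (x - y) = cinner z x - cinner z (y::'a::complex_hilbert)"
  by (metis add_diff_cancel cinner_add_right diff_add_cancel)

lemma cinner_sum_left: "cinner (\<Sum>i\<in>I. f i) y = (\<Sum>i\<in>I. cinner (f i) (y::'a::complex_hilbert))"
  by (induction I rule: infinite_finite_induct) (auto simp: cinner_add_left)

lemma cinner_sum_right: "cinner y (\<Sum>i\<in>I. f i) = (\<Sum>i\<in>I. cinner y (f i::'a::complex_hilbert))"
  by (induction I rule: infinite_finite_induct) (auto simp: cinner_add_right)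

lemma power2_norm_eq_cinner: "(norm x)\<^sup>2 = Re (cinner x (x::'a::complex_hilbert))"
  by (simp add: cinner_self)

text \<open>The class axioms give norm homogeneity for real scalars only. For complex scalars it is
  recovered from \<open>cinner_self\<close>, since both arguments of the inner product contribute a
  factor and \<open>c * cnj c\<close> is the squared modulus.\<close>

lemma norm_scaleC: "norm (c *\<^sub>C x) = cmod c * norm (x::'a::complex_hilbert)"
proof -
  have "complex_of_real ((norm (c *\<^sub>C x))\<^sup>2) = (c * cnj c) * cinner x x"
    by (simp only: cinner_self[symmetric] cinner_scaleC_left cinner_scaleC_right mult_ac)
  also have "\<dots> = complex_of_real ((cmod c * norm x)\<^sup>2)"
    by (simp add: complex_norm_square power_mult_distrib cinner_self del: of_real_power)
  finally have "(norm (c *\<^sub>C x))\<^sup>2 = (cmod c * norm x)\<^sup>2"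
    using of_real_eq_iff by blast
  thus ?thesis by (simp add: power2_eq_iff_nonneg)
qed

lemma scaleC_scaleR_commute: "c *\<^sub>C (r *\<^sub>R x) = r *\<^sub>R (c *\<^sub>C (x::'a::complex_hilbert))"
  by (metis scaleC_of_real scaleC_scaleC mult.commute)

lemma bounded_linear_scaleC: "bounded_linear (\<lambda>x::'a::complex_hilbert. c *\<^sub>C x)"
  by (rule bounded_linear_intro[where K = "cmod c"])
     (auto simp: scaleC_add_right scaleC_scaleR_commute norm_scaleC mult.commute)

lemma norm_add_sq:
  "(norm (x + y))\<^sup>2 = (norm x)\<^sup>2 + (norm y)\<^sup>2 + 2 * Re (cinner x (y::'a::complex_hilbert))"
proof -
  have "Re (cinner y x) = Re (cinner x y)" by (subst cinner_commute) simp
  thus ?thesis by (simp add: power2_norm_eq_cinner cinner_add_left cinner_add_right)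
qed

lemma norm_diff_sq:
  "(norm (x - y))\<^sup>2 = (norm x)\<^sup>2 + (norm y)\<^sup>2 - 2 * Re (cinner x (y::'a::complex_hilbert))"
proof -
  have "Re (cinner y x) = Re (cinner x y)" by (subst cinner_commute) simp
  thus ?thesis by (simp add: power2_norm_eq_cinner cinner_diff_left cinner_diff_right)
qed

text \<open>The triangle inequality is already part of the normed structure, so the real part of
  Cauchy-Schwarz follows by squaring it and cancelling the square terms.\<close>

lemma Re_cinner_le: "Re (cinner x y) \<le> norm x * norm (y::'a::complex_hilbert)"
proof -
  have "(norm (x + y))\<^sup>2 \<le> (norm x + norm y)\<^sup>2"
    by (simp add: norm_triangle_ineq power_mono)
  thus ?thesis by (simp add: norm_add_sq power2_sum)
qed

text \<open>Multiplying \<open>x\<close> by a unimodular phase \<open>u\<close> makes the inner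
  product real and nonnegative without changing the norm of \<open>x\<close>, which reduces the
  claim to the bound on real parts.\<close>

lemma norm_cinner_le: "cmod (cinner x y) \<le> norm x * norm (y::'a::complex_hilbert)"
proof (cases "cinner x y = 0")
  case False
  define u where "u = cnj (sgn (cinner x y))"
  have u: "cmod u = 1" using False by (simp add: u_def norm_sgn)
  have "cnj (cinner x y) * cinner x y = complex_of_real ((cmod (cinner x y))\<^sup>2)"
    unfolding complex_norm_square by (rule mult.commute)
  hence "u * cinner x y = complex_of_real (cmod (cinner x y))"
    using False unfolding u_def sgn_eq by (simp add: field_simps power2_eq_square)
  hence "cmod (cinner x y) = Re (cinner (u *\<^sub>C x) y)"
    by (simp add: cinner_scaleC_left)
  also have "\<dots> \<le> norm (u *\<^sub>C x) * norm y" by (rule Re_cinner_le)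
  finally show ?thesis by (simp add: norm_scaleC u)
qed simp

lemma bounded_linear_cinner_left: "bounded_linear (\<lambda>x::'a::complex_hilbert. cinner x y)"
proof (rule bounded_linear_intro[where K = "norm y"])
  show "cinner (r *\<^sub>R x) y = r *\<^sub>R cinner x y" for r and x :: 'a
    by (metis cinner_scaleC_left scaleC_of_real scaleR_conv_of_real)
qed (auto simp: cinner_add_left norm_cinner_le)

lemma norm_sum_orthogonal_sq:
  fixes f :: "'i \<Rightarrow> 'a::complex_hilbert"
  assumes "finite I" "\<And>i j. i \<in> I \<Longrightarrow> j \<in> I \<Longrightarrow> i \<noteq> j \<Longrightarrow> cinner (f i) (f j) = 0"
  shows "(norm (\<Sum>i\<in>I. f i))\<^sup>2 = (\<Sum>i\<in>I. (norm (f i))\<^sup>2)"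
  using assms
proof (induction I rule: finite_induct)
  case (insert i I)
  have "cinner (f i) (\<Sum>j\<in>I. f j) = 0"
    unfolding cinner_sum_right using insert.hyps insert.prems by (intro sum.neutral) auto
  thus ?case using insert by (simp add: norm_add_sq)
qed simp

text \<open>Real scalars act as embedded complex scalars, so complex linearity restricts to real
  linearity. This opens the theory of real bounded operators, in particular the exchange of such
  operators with infinite sums.\<close>

lemma clinear_bounded_linear:
  fixes f :: "'a::complex_hilbert \<Rightarrow> 'a"
  assumes "clinear f" "\<And>x. norm (f x) \<le> K * norm x"
  shows "bounded_linear f"
proof -
  interpret Vector_Spaces.linear scaleC scaleC f by fact
  show ?thesis
  proof (rule bounded_linear_intro[where K = K])
    show "f (r *\<^sub>R x) = r *\<^sub>R f x" for r x
      using scale[of "complex_of_real r" x] by (simp only: scaleC_of_real)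
  qed (use assms in \<open>auto simp: add mult.commute\<close>)
qed

lemma bounded_clinear_bounded_linear: "bounded_clinear f \<Longrightarrow> bounded_linear f"
  unfolding bounded_clinear_def using clinear_bounded_linear by blast

lemma clinearI:
  fixes f :: "'a::complex_hilbert \<Rightarrow> 'a"
  assumes "\<And>x y. f (x + y) = f x + f y" "\<And>c x. f (c *\<^sub>C x) = c *\<^sub>C f x"
  shows "clinear f"
  by unfold_locales (use assms in auto)

lemma bounded_clinearI:
  fixes f :: "'a::complex_hilbert \<Rightarrow> 'a"
  assumes "\<And>x y. f (x + y) = f x + f y" "\<And>c x. f (c *\<^sub>C x) = c *\<^sub>C f x"
    "\<And>x. norm (f x) \<le> K * norm x"
  shows "bounded_clinear f"
  unfolding bounded_clinear_def using clinearI[OF assms(1,2)] assms(3) by blast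

lemma bounded_clinear_scaleC: "bounded_clinear f \<Longrightarrow> f (c *\<^sub>C x) = c *\<^sub>C f x"
  unfolding bounded_clinear_def Vector_Spaces.linear_iff_module_hom by (simp add: module_hom.scale)

lemma clinear_isometry_bounded_clinear: "clinear_isometry f \<Longrightarrow> bounded_clinear f"
  unfolding clinear_isometry_def bounded_clinear_def by (auto intro: exI[of _ 1])

lemma bounded_clinear_add: "bounded_clinear f \<Longrightarrow> f (x + y) = f x + f y"
  using bounded_clinear_bounded_linear linear_simps(1) by blast

lemma bounded_clinear_sum: "bounded_clinear f \<Longrightarrow> f (\<Sum>i\<in>I. g i) = (\<Sum>i\<in>I. f (g i))"
  using bounded_clinear_bounded_linear bounded_linear.linear linear_sum by blast

lemma bounded_clinear_compose:
  assumes "bounded_clinear f" "bounded_clinear g"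
  shows "bounded_clinear (\<lambda>x. f (g x))"
proof -
  obtain K L where K: "\<And>x. norm (f x) \<le> K * norm x" and L: "\<And>x. norm (g x) \<le> L * norm x"
    using assms unfolding bounded_clinear_def by blast
  show ?thesis
  proof (rule bounded_clinearI[where K = "\<bar>K\<bar> * L"])
    fix x
    have "norm (f (g x)) \<le> K * norm (g x)" by (rule K)
    also have "\<dots> \<le> \<bar>K\<bar> * (L * norm x)" by (intro mult_mono L) auto
    finally show "norm (f (g x)) \<le> \<bar>K\<bar> * L * norm x" by (simp add: mult.assoc)
  qed (simp_all add: bounded_clinear_add[OF assms(1)] bounded_clinear_add[OF assms(2)]
      bounded_clinear_scaleC[OF assms(1)] bounded_clinear_scaleC[OF assms(2)])
qed

lemma bounded_clinear_scaleR:
  assumes "bounded_clinear f"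
  shows "bounded_clinear (\<lambda>x. r *\<^sub>R f x)"
proof -
  obtain K where K: "\<And>x. norm (f x) \<le> K * norm x"
    using assms unfolding bounded_clinear_def by blast
  show ?thesis
    by (rule bounded_clinearI[where K = "\<bar>r\<bar> * K"])
       (simp_all add: bounded_clinear_add[OF assms] bounded_clinear_scaleC[OF assms]
          scaleR_add_right scaleC_scaleR_commute mult.assoc mult_left_mono[OF K])
qed

lemma bounded_clinear_power: "bounded_clinear f \<Longrightarrow> bounded_clinear (f ^^ k)"
proof (induction k)
  case 0
  show ?case by (rule bounded_clinearI[where K = 1]) simp_all
next
  case (Suc k)
  thus ?case using bounded_clinear_compose[of f "f ^^ k"] by (simp add: comp_def)
qed

text \<open>The lower bound does two things: it forces a trivial kernel, and, read at
  \<open>inv T x\<close>, it bounds the inverse by \<open>1 / m\<close>.\<close>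

lemma boundedly_invertibleI:
  assumes T: "bounded_clinear T" and surj: "surj T"
    and lower: "\<And>x. m * norm x \<le> norm (T x)" and m: "m > 0"
  shows "boundedly_invertible T"
proof -
  have "inj T"
  proof (rule injI)
    fix x y assume "T x = T y"
    hence "T (x - y) = 0"
      by (simp add: linear_simps(2)[OF bounded_clinear_bounded_linear[OF T]])
    hence "m * norm (x - y) \<le> 0" using lower[of "x - y"] by simp
    thus "x = y" using m by (simp add: mult_le_0_iff)
  qed
  hence left: "inv T (T x) = x" for x by (rule inv_f_f)
  have right: "T (inv T x) = x" for x by (rule surj_f_inv_f[OF surj])
  have "bounded_clinear (inv T)"
  proof (rule bounded_clinearI[where K = "1 / m"])
    show "inv T (x + y) = inv T x + inv T y" for x y
      using left[of "inv T x + inv T y"] by (simp add: bounded_clinear_add[OF T] right)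
    show "inv T (c *\<^sub>C x) = c *\<^sub>C inv T x" for c x
      using left[of "c *\<^sub>C inv T x"] by (simp add: bounded_clinear_scaleC[OF T] right)
    show "norm (inv T x) \<le> 1 / m * norm x" for x
      using lower[of "inv T x"] m by (simp add: right field_simps)
  qed
  thus ?thesis unfolding boundedly_invertible_def using left right by blast
qed

section \<open>Orthonormal bases and diagonal operators\<close>

context
  fixes e :: "nat \<Rightarrow> 'h::complex_hilbert"
  assumes basis: "orthonormal_basis e"
begin

lemma cinner_basis: "m \<ge> 1 \<Longrightarrow> n \<ge> 1 \<Longrightarrow> cinner (e m) (e n) = (if m = n then 1 else 0)"
  using basis unfolding orthonormal_basis_def by blast

lemma norm_basis: "n \<ge> 1 \<Longrightarrow> norm (e n) = 1"
proof -
  assume "n \<ge> 1"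
  hence "(norm (e n))\<^sup>2 = 1\<^sup>2" by (simp add: power2_norm_eq_cinner cinner_basis)
  thus ?thesis by (rule power2_eq_imp_eq) auto
qed

lemma norm_sum_basis_sq:
  assumes "finite F" "F \<subseteq> {1..}"
  shows "(norm (\<Sum>n\<in>F. c n *\<^sub>C e n))\<^sup>2 = (\<Sum>n\<in>F. (cmod (c n))\<^sup>2)"
proof -
  have "(norm (\<Sum>n\<in>F. c n *\<^sub>C e n))\<^sup>2 = (\<Sum>n\<in>F. (norm (c n *\<^sub>C e n))\<^sup>2)"
    using assms by (intro norm_sum_orthogonal_sq)
      (auto simp: cinner_scaleC_left cinner_scaleC_right cinner_basis subset_eq)
  also have "\<dots> = (\<Sum>n\<in>F. (cmod (c n))\<^sup>2)"
    using assms by (intro sum.cong) (auto simp: norm_scaleC norm_basis subset_eq)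
  finally show ?thesis .
qed

text \<open>By orthonormality, squared distances between finite partial sums are differences of
  partial sums of the squared coefficients. The vector sums therefore form a Cauchy filter, and
  completeness supplies the limit.\<close>

lemma riesz_fischer:
  assumes "(\<lambda>n. (cmod (c n))\<^sup>2) summable_on {1..}"
  shows "(\<lambda>n. c n *\<^sub>C e n) summable_on {1..}"
proof -
  let ?f = "\<lambda>n. c n *\<^sub>C e n" and ?A = "{1..}::nat set"
  have "\<exists>P. eventually P (finite_subsets_at_top ?A) \<and>
          (\<forall>F F'. P F \<and> P F' \<longrightarrow> dist (sum ?f F) (sum ?f F') < \<epsilon>)" if \<epsilon>: "\<epsilon> > 0" for \<epsilon>
  proof -
    from assms obtain L where lim: "(sum (\<lambda>n. (cmod (c n))\<^sup>2) \<longlongrightarrow> L) (finite_subsets_at_top ?A)"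
      unfolding has_sum_def summable_on_def by blast
    \<comment> \<open>Two scalar sums within this distance of \<open>L\<close> differ by less than
      \<open>(\<epsilon> / 2)\<close> squared; the two halves of \<open>\<epsilon>\<close> are then
      spent on comparing \<open>F\<close> and \<open>F'\<close> with the common set
      \<open>F0\<close>.\<close>
    have \<delta>: "(\<epsilon> / 2)\<^sup>2 / 2 > 0" using \<epsilon> by simp
    have "eventually (\<lambda>F. dist (\<Sum>n\<in>F. (cmod (c n))\<^sup>2) L < (\<epsilon> / 2)\<^sup>2 / 2) (finite_subsets_at_top ?A)"
      using lim \<delta> unfolding tendsto_iff by blast
    then obtain F0 where F0: "finite F0" "F0 \<subseteq> ?A"
      and le: "\<And>F. finite F \<Longrightarrow> F0 \<subseteq> F \<Longrightarrow> F \<subseteq> ?A \<Longrightarrow>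
        dist (\<Sum>n\<in>F. (cmod (c n))\<^sup>2) L < (\<epsilon> / 2)\<^sup>2 / 2"
      unfolding eventually_finite_subsets_at_top by metis
    define P where "P F \<longleftrightarrow> finite F \<and> F0 \<subseteq> F \<and> F \<subseteq> ?A" for F
    have "eventually P (finite_subsets_at_top ?A)"
      unfolding eventually_finite_subsets_at_top P_def using F0 by (intro exI[of _ F0]) simp
    moreover have near: "dist (sum ?f F) (sum ?f F0) < \<epsilon> / 2" if "P F" for F
    proof -
      have F: "finite F" "F0 \<subseteq> F" "F \<subseteq> ?A" using that by (auto simp: P_def)
      have "(dist (sum ?f F) (sum ?f F0))\<^sup>2 = (\<Sum>n\<in>F - F0. (cmod (c n))\<^sup>2)"
        using F norm_sum_basis_sq[of "F - F0" c] by (simp add: dist_norm sum_diff subset_eq)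
      also have "\<dots> = (\<Sum>n\<in>F. (cmod (c n))\<^sup>2) - (\<Sum>n\<in>F0. (cmod (c n))\<^sup>2)"
        using F by (simp add: sum_diff)
      also have "\<dots> < (\<epsilon> / 2)\<^sup>2"
        using le[OF F] le[OF F0(1) order.refl F0(2)] unfolding dist_real_def by linarith
      finally show ?thesis by (rule power_less_imp_less_base) (use \<epsilon> in simp)
    qed
    moreover have "dist (sum ?f F) (sum ?f F') < \<epsilon>" if "P F" "P F'" for F F'
      using near[OF that(1)] near[OF that(2)] dist_triangle2[of "sum ?f F" "sum ?f F'" "sum ?f F0"]
      by linarith
    ultimately show ?thesis by (intro exI[of _ P] conjI allI impI) simp_all
  qed
  hence "cauchy_filter (filtermap (sum ?f) (finite_subsets_at_top ?A))"
    by (simp add: cauchy_filter_metric_filtermap)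
  moreover have "complete (UNIV::'h set)" by (rule complete_UNIV)
  ultimately obtain L' where "(sum ?f \<longlongrightarrow> L') (finite_subsets_at_top ?A)"
    using complete_uniform[where S=UNIV] by (force simp add: filterlim_def)
  thus ?thesis using summable_on_def has_sum_def by blast
qed

text \<open>Expand the nonnegative quantity \<open>norm (x - ?S)\<close> squared, where
  \<open>?S\<close> is the projection of \<open>x\<close> onto the chosen basis vectors.\<close>

lemma bessel:
  assumes "finite F" "F \<subseteq> {1..}"
  shows "(\<Sum>n\<in>F. (cmod (cinner x (e n)))\<^sup>2) \<le> (norm x)\<^sup>2"
proof -
  let ?S = "\<Sum>n\<in>F. cinner x (e n) *\<^sub>C e n"
  have "cinner x ?S = complex_of_real (\<Sum>n\<in>F. (cmod (cinner x (e n)))\<^sup>2)"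
    unfolding cinner_sum_right cinner_scaleC_right of_real_sum complex_norm_square
    by (simp add: mult.commute)
  hence "Re (cinner x ?S) = (\<Sum>n\<in>F. (cmod (cinner x (e n)))\<^sup>2)"
    by (simp only: Re_complex_of_real)
  hence "0 \<le> (norm x)\<^sup>2 + (norm ?S)\<^sup>2 - 2 * (\<Sum>n\<in>F. (cmod (cinner x (e n)))\<^sup>2)"
    using norm_diff_sq[of x ?S] zero_le_power2[of "norm (x - ?S)"] by linarith
  thus ?thesis using norm_sum_basis_sq[OF assms] by simp
qed

lemma coeff_sq_summable: "(\<lambda>n. (cmod (cinner x (e n)))\<^sup>2) summable_on {1..}"
  by (rule nonneg_bounded_partial_sums_imp_summable_on[where C = "(norm x)\<^sup>2"])
     (auto intro!: eventually_finite_subsets_at_top_weakI bessel)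

lemma cinner_has_sum_basis:
  assumes "((\<lambda>n. c n *\<^sub>C e n) has_sum y) {1..}" "m \<ge> 1"
  shows "cinner y (e m) = c m"
proof -
  have "((\<lambda>n. cinner (c n *\<^sub>C e n) (e m)) has_sum cinner y (e m)) {1..}"
    using has_sum_bounded_linear[OF bounded_linear_cinner_left assms(1)] .
  moreover have "((\<lambda>n. cinner (c n *\<^sub>C e n) (e m)) has_sum c m) {1..}"
    using assms(2)
    by (intro has_sum_finite_neutralI[where B = "{m}"])
       (auto simp: cinner_scaleC_left cinner_basis)
  ultimately show ?thesis using has_sum_unique by blast
qed

text \<open>The vectors orthogonal to \<open>z\<close> form a closed set containing the span of the
  basis. Density puts \<open>z\<close> itself into this set, so
  \<open>cinner z z = 0\<close>.\<close>

lemma orthogonal_basis_imp_zero: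
  assumes "\<And>n. n \<ge> 1 \<Longrightarrow> cinner z (e n) = 0"
  shows "z = 0"
proof -
  have basis_orth: "cinner (e n) z = 0" if "n \<ge> 1" for n
    using assms[OF that] by (subst cinner_commute) simp
  have cspan: "cinner y z = 0" if "y \<in> cspan (e ` {1..})" for y
    using that
  proof (induction rule: complex_vector.span_induct_alt)
    case (step c x y)
    thus ?case using assms
      by (auto simp: cinner_add_left cinner_scaleC_left basis_orth)
  qed simp
  have "closed {y. cinner y z = 0}"
    by (intro closed_Collect_eq bounded_linear.continuous_on[OF bounded_linear_cinner_left]
        continuous_intros)
  hence "closure (cspan (e ` {1..})) \<subseteq> {y. cinner y z = 0}"
    using cspan by (intro closure_minimal) auto
  hence "cinner z z = 0"
    using basis unfolding orthonormal_basis_def by blast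
  thus ?thesis by (simp add: cinner_self)
qed

text \<open>The Fourier series converges to some \<open>y\<close> by Bessel and Riesz-Fischer;
  \<open>y\<close> and \<open>x\<close> have the same coefficients, hence coincide.\<close>

lemma basis_expansion: "((\<lambda>n. cinner x (e n) *\<^sub>C e n) has_sum x) {1..}"
proof -
  obtain y where y: "((\<lambda>n. cinner x (e n) *\<^sub>C e n) has_sum y) {1..}"
    using riesz_fischer[OF coeff_sq_summable] unfolding summable_on_def by blast
  have "y - x = 0"
    by (rule orthogonal_basis_imp_zero) (simp add: cinner_diff_left cinner_has_sum_basis[OF y])
  thus ?thesis using y by simp
qed

lemma parseval: "((\<lambda>n. (cmod (cinner x (e n)))\<^sup>2) has_sum (norm x)\<^sup>2) {1..}"
proof -
  have "((\<lambda>n. Re (cinner (cinner x (e n) *\<^sub>C e n) x)) has_sum Re (cinner x x)) {1..}"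
    by (intro has_sum_bounded_linear[OF bounded_linear_Re]
        has_sum_bounded_linear[OF bounded_linear_cinner_left] basis_expansion)
  moreover have "cinner (cinner x (e n) *\<^sub>C e n) x = complex_of_real ((cmod (cinner x (e n)))\<^sup>2)" for n
    unfolding cinner_scaleC_left complex_norm_square by (metis cinner_commute)
  ultimately show ?thesis by (simp add: power2_norm_eq_cinner del: of_real_power)
qed

section \<open>Bounded diagonal operators\<close>

lemma diag_has_sum:
  assumes "\<forall>n\<ge>1. cmod (a n) \<le> K"
  shows "((\<lambda>n. (a n * cinner x (e n)) *\<^sub>C e n) has_sum diag e a x) {1..}"
proof -
  have "(\<lambda>n. K\<^sup>2 * (cmod (cinner x (e n)))\<^sup>2) summable_on {1..}"
    by (intro summable_on_cmult_right coeff_sq_summable)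
  hence "(\<lambda>n. (cmod (a n * cinner x (e n)))\<^sup>2) summable_on {1..}"
  proof (rule summable_on_comparison_test)
    fix n :: nat assume "n \<in> {1..}"
    hence n: "n \<ge> 1" by simp
    show "(cmod (a n * cinner x (e n)))\<^sup>2 \<le> K\<^sup>2 * (cmod (cinner x (e n)))\<^sup>2"
      unfolding norm_mult power_mult_distrib
      using assms n by (intro mult_right_mono power_mono) simp_all
  qed simp
  from riesz_fischer[OF this] show ?thesis
    unfolding diag_def by (rule has_sum_infsum)
qed

lemma cinner_diag:
  assumes "\<forall>n\<ge>1. cmod (a n) \<le> K" "m \<ge> 1"
  shows "cinner (diag e a x) (e m) = a m * cinner x (e m)"
  using cinner_has_sum_basis[OF diag_has_sum[OF assms(1)] assms(2)] .

lemma eq_if_coeffs_eq: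
  assumes "\<And>n. n \<ge> 1 \<Longrightarrow> cinner x (e n) = cinner y (e n)"
  shows "x = y"
  using orthogonal_basis_imp_zero[of "x - y"] assms by (simp add: cinner_diff_left)

lemma norm_diag_le:
  assumes "\<forall>n\<ge>1. cmod (a n) \<le> K"
  shows "norm (diag e a x) \<le> K * norm x"
proof -
  have "cmod (a 1) \<le> K" using assms by simp
  hence K: "K \<ge> 0" using norm_ge_zero[of "a 1"] by linarith
  have "(norm (diag e a x))\<^sup>2 \<le> K\<^sup>2 * (norm x)\<^sup>2"
  proof (rule has_sum_mono[OF parseval has_sum_cmult_right[OF parseval]])
    fix n :: nat assume "n \<in> {1..}"
    hence n: "n \<ge> 1" by simp
    show "(cmod (cinner (diag e a x) (e n)))\<^sup>2 \<le> K\<^sup>2 * (cmod (cinner x (e n)))\<^sup>2"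
      unfolding cinner_diag[OF assms n] norm_mult power_mult_distrib
      using assms n by (intro mult_right_mono power_mono) simp_all
  qed
  hence "(norm (diag e a x))\<^sup>2 \<le> (K * norm x)\<^sup>2" by (simp only: power_mult_distrib)
  thus ?thesis by (rule power2_le_imp_le) (use K in simp)
qed

lemma norm_diag_ge:
  assumes "\<forall>n\<ge>1. cmod (a n) \<le> K" "\<forall>n\<ge>1. c \<le> cmod (a n)" "c \<ge> 0"
  shows "c * norm x \<le> norm (diag e a x)"
proof -
  have "c\<^sup>2 * (norm x)\<^sup>2 \<le> (norm (diag e a x))\<^sup>2"
  proof (rule has_sum_mono[OF has_sum_cmult_right[OF parseval] parseval])
    fix n :: nat assume "n \<in> {1..}"
    hence n: "n \<ge> 1" by simp
    show "c\<^sup>2 * (cmod (cinner x (e n)))\<^sup>2 \<le> (cmod (cinner (diag e a x) (e n)))\<^sup>2"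
      unfolding cinner_diag[OF assms(1) n] norm_mult power_mult_distrib
      using assms n by (intro mult_right_mono power_mono) simp_all
  qed
  hence "(c * norm x)\<^sup>2 \<le> (norm (diag e a x))\<^sup>2" by (simp only: power_mult_distrib)
  thus ?thesis by (rule power2_le_imp_le) simp
qed

lemma bounded_clinear_diag:
  assumes "\<forall>n\<ge>1. cmod (a n) \<le> K"
  shows "bounded_clinear (diag e a)"
proof (rule bounded_clinearI)
  show "diag e a (x + y) = diag e a x + diag e a y" for x y
    by (rule eq_if_coeffs_eq)
       (simp add: cinner_diag[OF assms] cinner_add_left algebra_simps)
  show "diag e a (c *\<^sub>C x) = c *\<^sub>C diag e a x" for c x
    by (rule eq_if_coeffs_eq)
       (simp add: cinner_diag[OF assms] cinner_scaleC_left algebra_simps)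
  show "norm (diag e a x) \<le> K * norm x" for x
    by (rule norm_diag_le[OF assms])
qed

lemma bounded_diagI:
  assumes "\<forall>n\<ge>1. cmod (a n) \<le> K"
  shows "bounded_diag e a"
proof -
  have "(\<lambda>n. (a n * cinner x (e n)) *\<^sub>C e n) summable_on {1..}" for x
    using diag_has_sum[OF assms] by (rule has_sum_imp_summable)
  moreover have "bounded_clinear (diag e a)" by (rule bounded_clinear_diag[OF assms])
  ultimately show ?thesis by (simp add: bounded_diag_def diag_domain_def)
qed

text \<open>Only one term of the defining series is nonzero, so no bound on \<open>a\<close> is
  assumed. This is what allows a bound on the entries to be read off from a bound on the
  operator.\<close>

lemma diag_basis: "n \<ge> 1 \<Longrightarrow> diag e a (e n) = a n *\<^sub>C e n"
proof -
  assume n: "n \<ge> 1"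
  have "((\<lambda>m. (a m * cinner (e n) (e m)) *\<^sub>C e m) has_sum a n *\<^sub>C e n) {1..}"
    using n by (intro has_sum_finite_neutralI[where B = "{n}"]) (auto simp: cinner_basis)
  thus ?thesis unfolding diag_def by (rule infsumI)
qed

lemma bounded_diagE:
  assumes "bounded_diag e a"
  obtains K where "\<forall>n\<ge>1. cmod (a n) \<le> K"
proof -
  obtain K where K: "\<And>x. norm (diag e a x) \<le> K * norm x"
    using assms unfolding bounded_diag_def bounded_clinear_def by blast
  have "cmod (a n) \<le> K" if "n \<ge> 1" for n
    using K[of "e n"] that by (simp add: diag_basis norm_scaleC norm_basis)
  thus ?thesis using that by blast
qed

lemma bounded_clinear_eq_on_basis:
  assumes "bounded_clinear f" "bounded_clinear g" "\<And>n. n \<ge> 1 \<Longrightarrow> f (e n) = g (e n)"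
  shows "f x = g x"
proof -
  have "((\<lambda>n. cinner x (e n) *\<^sub>C h (e n)) has_sum h x) {1..}" if "bounded_clinear h" for h
    using has_sum_bounded_linear[OF bounded_clinear_bounded_linear[OF that] basis_expansion[of x]]
    by (simp add: bounded_clinear_scaleC[OF that])
  note this[OF assms(1)] this[OF assms(2)]
  moreover have "((\<lambda>n. cinner x (e n) *\<^sub>C f (e n)) has_sum g x) {1..} \<longleftrightarrow>
     ((\<lambda>n. cinner x (e n) *\<^sub>C g (e n)) has_sum g x) {1..}"
    by (rule has_sum_cong) (use assms(3) in auto)
  ultimately show ?thesis using has_sum_unique by blast
qed

end

section \<open>Polynomials in an isometry\<close>

lemma root_unity_power:
  assumes "N > 0"
  shows "cis (2 * pi * real l / real N) ^ N = 1"
proof -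
  have "real N * (2 * pi * real l / real N) = 2 * pi * real l" using assms by simp
  thus ?thesis unfolding Complex.DeMoivre by (simp only: cis_multiple_2pi Ints_of_nat)
qed

lemma sum_root_unity_products:
  fixes i j N :: nat
  assumes "i < N" "j < N"
  defines "\<zeta> \<equiv> \<lambda>l::nat. cis (2 * pi * real l / real N)"
  shows "(\<Sum>l<N. \<zeta> l ^ i * cnj (\<zeta> l ^ j)) = (if i = j then of_nat N else 0)"
proof -
  \<comment> \<open>Index and exponent are interchangeable because both enter the angle as a
    product. The sum over \<open>l\<close> thus becomes a geometric series in
    \<open>q\<close>.\<close>
  have pow: "\<zeta> l ^ m = \<zeta> m ^ l" for l m
    unfolding \<zeta>_def Complex.DeMoivre by (rule arg_cong[where f = cis]) simp
  define q where "q = \<zeta> i * cnj (\<zeta> j)"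
  have "\<zeta> l ^ i * cnj (\<zeta> l ^ j) = q ^ l" for l
    unfolding q_def power_mult_distrib complex_cnj_power[symmetric] by (simp only: pow)
  hence sum: "(\<Sum>l<N. \<zeta> l ^ i * cnj (\<zeta> l ^ j)) = (\<Sum>l<N. q ^ l)" by simp
  have N: "N > 0" using assms by simp
  show ?thesis
  proof (cases "i = j")
    case True
    hence "q = 1" by (simp add: q_def \<zeta>_def cis_cnj cis_mult)
    thus ?thesis using True sum by simp
  next
    case False
    have bij: "bij_betw \<zeta> {..<N} {z. z ^ N = 1}"
      unfolding \<zeta>_def by (rule Complex.bij_betw_roots_unity[OF N])
    have root: "\<zeta> m ^ N = 1" for m
      unfolding \<zeta>_def by (rule root_unity_power[OF N])
    have "q ^ N = 1"
      unfolding q_def power_mult_distrib complex_cnj_power[symmetric]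
      by (simp add: root del: complex_cnj_power)
    \<comment> \<open>Distinct indices below \<open>N\<close> give distinct roots of unity, so
      \<open>q\<close> is a nontrivial \<open>N\<close>-th root of unity and its geometric sum
      vanishes.\<close>
    moreover have "q \<noteq> 1"
    proof
      assume "q = 1"
      hence "\<zeta> i * cnj (\<zeta> j) * \<zeta> j = \<zeta> j" by (simp add: q_def)
      hence "\<zeta> i = \<zeta> j" by (simp add: \<zeta>_def cis_cnj cis_mult)
      thus False using bij_betw_imp_inj_on[OF bij] assms False by (auto dest: inj_onD)
    qed
    ultimately show ?thesis using False sum by (simp add: geometric_sum)
  qed
qed

text \<open>Expanding the squared norms gives a triple sum; summing over the roots of unity first
  kills the off-diagonal inner products. The vectors \<open>y i\<close> need not be
  orthogonal.\<close>

lemma discrete_parseval: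
  fixes y :: "nat \<Rightarrow> 'h::complex_hilbert" and N :: nat
  defines "\<zeta> \<equiv> \<lambda>l::nat. cis (2 * pi * real l / real N)"
  shows "(\<Sum>l<N. (norm (\<Sum>i<N. (\<zeta> l ^ i) *\<^sub>C y i))\<^sup>2) = N * (\<Sum>i<N. (norm (y i))\<^sup>2)"
proof -
  have "complex_of_real (\<Sum>l<N. (norm (\<Sum>i<N. (\<zeta> l ^ i) *\<^sub>C y i))\<^sup>2) =
      (\<Sum>l<N. \<Sum>i<N. \<Sum>j<N. \<zeta> l ^ i * cnj (\<zeta> l ^ j) * cinner (y i) (y j))"
    unfolding of_real_sum cinner_self[symmetric] cinner_sum_left
    unfolding cinner_sum_right cinner_scaleC_left cinner_scaleC_right
    by (simp add: mult_ac)
  also have "\<dots> = (\<Sum>i<N. \<Sum>l<N. \<Sum>j<N. \<zeta> l ^ i * cnj (\<zeta> l ^ j) * cinner (y i) (y j))"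
    by (rule sum.swap)
  also have "\<dots> = (\<Sum>i<N. \<Sum>j<N. \<Sum>l<N. \<zeta> l ^ i * cnj (\<zeta> l ^ j) * cinner (y i) (y j))"
    by (rule sum.cong[OF refl], rule sum.swap)
  also have "\<dots> = (\<Sum>i<N. \<Sum>j<N. (if i = j then of_nat N else 0) * cinner (y i) (y j))"
    unfolding sum_distrib_right[symmetric] \<zeta>_def
    by (intro sum.cong refl arg_cong2[where f = "(*)"] sum_root_unity_products) auto
  also have "\<dots> = (\<Sum>i<N. of_nat N * cinner (y i) (y i))"
    by (intro sum.cong refl) (simp add: if_distrib[of "\<lambda>x. x * _"] cong: if_cong)
  also have "\<dots> = complex_of_real (N * (\<Sum>i<N. (norm (y i))\<^sup>2))"
    by (simp add: cinner_self sum_distrib_left)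
  finally show ?thesis using of_real_eq_iff by blast
qed

lemma isometry_power_norm: "clinear_isometry V \<Longrightarrow> norm ((V ^^ k) x) = norm x"
  by (induction k) (auto simp: clinear_isometry_def)

text \<open>For \<open>N\<close>-th roots of unity \<open>\<zeta>\<close> the vectors \<open>\<Sum>i<N. \<zeta>^i V^i x\<close> are approximate
  eigenvectors of the isometry \<open>V\<close> with eigenvalue \<open>cnj \<zeta>\<close>: the error stays bounded by
  \<open>2 * norm x\<close>, while their mean square norm \<open>N * (norm x)^2\<close> grows with \<open>N\<close>.\<close>

lemma isometry_polynomial_lower_bound:
  fixes V :: "'h::complex_hilbert \<Rightarrow> 'h" and A :: "nat \<Rightarrow> 'h \<Rightarrow> 'h"
  assumes V: "clinear_isometry V" and A: "\<And>k. k \<in> I \<Longrightarrow> bounded_clinear (A k)"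
    and comm: "\<And>k x. k \<in> I \<Longrightarrow> A k (V x) = V (A k x)"
    and lower: "\<And>\<omega> x. cmod \<omega> = 1 \<Longrightarrow> c * norm x \<le> norm (\<Sum>k\<in>I. (\<omega> ^ k) *\<^sub>C A k x)"
    and c: "c \<ge> 0"
  shows "c * norm x \<le> norm (\<Sum>k\<in>I. A k ((V ^^ k) x))"
proof -
  define Q where "Q x = (\<Sum>k\<in>I. A k ((V ^^ k) x))" for x
  have Vb: "bounded_clinear V" by (rule clinear_isometry_bounded_clinear[OF V])
  note V_simps = bounded_clinear_add[OF Vb] bounded_clinear_scaleC[OF Vb] bounded_clinear_sum[OF Vb]
    linear_simps(2)[OF bounded_clinear_bounded_linear[OF Vb]]
  have Vpow_sum: "(V ^^ k) (\<Sum>i\<in>J. g i *\<^sub>C y i) = (\<Sum>i\<in>J. g i *\<^sub>C (V ^^ k) (y i))" for k J g and y :: "nat \<Rightarrow> 'h"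
    by (induction k) (simp_all add: V_simps)
  have QV: "Q ((V ^^ i) y) = (V ^^ i) (Q y)" for i y
  proof (induction i)
    case (Suc i)
    have "Q (V z) = V (Q z)" for z
      unfolding Q_def V_simps by (intro sum.cong refl) (simp add: comm funpow_swap1[symmetric])
    thus ?case using Suc by simp
  qed simp
  have Q_sum: "Q (\<Sum>i\<in>J. g i *\<^sub>C y i) = (\<Sum>i\<in>J. g i *\<^sub>C Q (y i))" for J g and y :: "nat \<Rightarrow> 'h"
  proof -
    have "Q (\<Sum>i\<in>J. g i *\<^sub>C y i) = (\<Sum>k\<in>I. \<Sum>i\<in>J. g i *\<^sub>C A k ((V ^^ k) (y i)))"
      unfolding Q_def Vpow_sum
      by (intro sum.cong refl) (simp add: bounded_clinear_sum[OF A] bounded_clinear_scaleC[OF A])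
    also have "\<dots> = (\<Sum>i\<in>J. g i *\<^sub>C Q (y i))"
      unfolding Q_def complex_vector.scale_sum_right by (rule sum.swap)
    finally show ?thesis .
  qed
  have "\<exists>K. \<forall>x. norm (A k x) \<le> K * norm x" if "k \<in> I" for k
    using A[OF that] unfolding bounded_clinear_def by blast
  then obtain K where K: "\<And>k x. k \<in> I \<Longrightarrow> norm (A k x) \<le> K k * norm x" by metis
  \<comment> \<open>Replacing \<open>V ^^ k\<close> by \<open>\<omega> ^ k\<close> on an approximate
    eigenvector costs at most \<open>2 * k * norm x\<close>; \<open>C\<close> collects these errors,
    weighted by bounds for the \<open>A k\<close>.\<close>
  define C where "C = (\<Sum>k\<in>I. \<bar>K k\<bar> * (2 * k))"
  have C: "C \<ge> 0" unfolding C_def by (intro sum_nonneg) simp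
  \<comment> \<open>The error term carries \<open>sqrt N\<close> while the other terms carry
    \<open>N\<close>, so division by \<open>N\<close> makes it vanish in the limit.\<close>
  have main: "c * N * norm x \<le> N * norm (Q x) + sqrt N * (C * norm x)" for N :: nat
  proof (cases "N = 0")
    case False
    define \<zeta> where "\<zeta> = (\<lambda>l::nat. cis (2 * pi * real l / real N))"
    define X where "X l = (\<Sum>i<N. (\<zeta> l ^ i) *\<^sub>C (V ^^ i) x)" for l
    \<comment> \<open>Since \<open>Q\<close> commutes with \<open>V\<close>, \<open>Q (X l)\<close>
      is the same combination built from \<open>Q x\<close>; the mean square computation therefore
      applies to both vectors.\<close>
    have QX: "Q (X l) = (\<Sum>i<N. (\<zeta> l ^ i) *\<^sub>C (V ^^ i) (Q x))" for l
      unfolding X_def Q_sum QV ..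
    have pointwise: "c * norm (X l) \<le> norm (Q (X l)) + C * norm x" for l
    proof -
      \<comment> \<open>This is the inverse of the unimodular number \<open>\<zeta> l\<close>:
        applying \<open>V\<close> shifts the summation index by one, which amounts to this factor up
        to boundary terms.\<close>
      define \<omega> where "\<omega> = cnj (\<zeta> l)"
      have \<omega>: "cmod \<omega> = 1" "\<omega> * \<zeta> l = 1" by (auto simp: \<omega>_def \<zeta>_def cis_cnj cis_mult)
      have unity: "\<zeta> l ^ N = 1"
        unfolding \<zeta>_def using False by (intro root_unity_power) simp
      \<comment> \<open>Only the two ends of the shifted sum survive, and the coefficient at the
        upper end is \<open>1\<close> because \<open>\<zeta> l\<close> is an \<open>N\<close>-th
        root of unity.\<close>
      have telescope: "\<zeta> l *\<^sub>C V (X l) - X l = (V ^^ N) x - x"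
      proof -
        have "\<zeta> l *\<^sub>C V (X l) - X l = (\<Sum>i<N. (\<zeta> l ^ Suc i) *\<^sub>C (V ^^ Suc i) x - (\<zeta> l ^ i) *\<^sub>C (V ^^ i) x)"
          unfolding X_def V_simps complex_vector.scale_sum_right sum_subtractf
          by (simp add: scaleC_scaleC)
        also have "\<dots> = (\<zeta> l ^ N) *\<^sub>C (V ^^ N) x - (\<zeta> l ^ 0) *\<^sub>C (V ^^ 0) x"
          by (rule sum_lessThan_telescope)
        finally show ?thesis using unity by simp
      qed
      have step: "norm (V (X l) - \<omega> *\<^sub>C X l) \<le> 2 * norm x"
      proof -
        have "V (X l) - \<omega> *\<^sub>C X l = \<omega> *\<^sub>C (\<zeta> l *\<^sub>C V (X l) - X l)"
          by (simp add: complex_vector.scale_right_diff_distrib scaleC_scaleC \<omega>)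
        hence "norm (V (X l) - \<omega> *\<^sub>C X l) = norm ((V ^^ N) x - x)"
          by (simp add: telescope norm_scaleC \<omega>)
        also have "\<dots> \<le> norm ((V ^^ N) x) + norm x" by (rule norm_triangle_ineq4)
        finally show ?thesis by (simp add: isometry_power_norm[OF V])
      qed
      have approx: "norm ((V ^^ k) (X l) - (\<omega> ^ k) *\<^sub>C X l) \<le> 2 * k * norm x" for k
      proof (induction k)
        case (Suc k)
        have "(V ^^ Suc k) (X l) - (\<omega> ^ Suc k) *\<^sub>C X l =
            V ((V ^^ k) (X l) - (\<omega> ^ k) *\<^sub>C X l) + (\<omega> ^ k) *\<^sub>C (V (X l) - \<omega> *\<^sub>C X l)"
          by (simp add: V_simps complex_vector.scale_right_diff_distrib scaleC_scaleC mult.commute)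
        also have "norm \<dots> \<le>
            norm (V ((V ^^ k) (X l) - (\<omega> ^ k) *\<^sub>C X l)) + norm ((\<omega> ^ k) *\<^sub>C (V (X l) - \<omega> *\<^sub>C X l))"
          by (rule norm_triangle_ineq)
        also have "\<dots> \<le> 2 * k * norm x + 2 * norm x"
          using Suc step V by (intro add_mono) (auto simp: clinear_isometry_def norm_scaleC norm_power \<omega>)
        finally show ?case by (simp add: algebra_simps)
      qed simp
      have "(\<Sum>k\<in>I. (\<omega> ^ k) *\<^sub>C A k (X l)) - Q (X l) =
          (\<Sum>k\<in>I. A k ((\<omega> ^ k) *\<^sub>C X l - (V ^^ k) (X l)))"
        unfolding Q_def sum_subtractf[symmetric]
        by (intro sum.cong refl)
           (simp add: linear_simps(2)[OF bounded_clinear_bounded_linear[OF A]] bounded_clinear_scaleC[OF A])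
      also have "norm \<dots> \<le> (\<Sum>k\<in>I. \<bar>K k\<bar> * (2 * k) * norm x)"
      proof (rule sum_norm_le)
        fix k assume k: "k \<in> I"
        have "norm (A k ((\<omega> ^ k) *\<^sub>C X l - (V ^^ k) (X l))) \<le>
            K k * norm ((\<omega> ^ k) *\<^sub>C X l - (V ^^ k) (X l))" by (rule K[OF k])
        also have "\<dots> \<le> \<bar>K k\<bar> * (2 * k * norm x)"
          using approx[of k] by (intro mult_mono) (auto simp: norm_minus_commute)
        finally show "norm (A k ((\<omega> ^ k) *\<^sub>C X l - (V ^^ k) (X l))) \<le> \<bar>K k\<bar> * (2 * k) * norm x"
          by (simp add: mult_ac)
      qed
      also have "\<dots> = C * norm x" by (simp add: C_def sum_distrib_right)
      finally have "norm (\<Sum>k\<in>I. (\<omega> ^ k) *\<^sub>C A k (X l)) \<le> norm (Q (X l)) + C * norm x"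
        using norm_triangle_ineq2[of "\<Sum>k\<in>I. (\<omega> ^ k) *\<^sub>C A k (X l)" "Q (X l)"] by linarith
      thus ?thesis using lower[OF \<omega>(1), of "X l"] by linarith
    qed
    \<comment> \<open>Discrete Parseval with \<open>y i = (V ^^ i) y\<close>: all these vectors have
      norm \<open>norm y\<close>, so the sum of squares is
      \<open>N * N * (norm y)^2\<close>.\<close>
    have L2: "L2_set (\<lambda>l. norm (\<Sum>i<N. (\<zeta> l ^ i) *\<^sub>C (V ^^ i) y)) {..<N} = N * norm y" for y
      unfolding L2_set_def \<zeta>_def discrete_parseval
      by (simp add: isometry_power_norm[OF V] real_sqrt_mult)
    have "c * (N * norm x) = L2_set (\<lambda>l. c * norm (X l)) {..<N}"
      unfolding X_def using c by (simp add: L2_set_right_distrib[symmetric] L2)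
    also have "\<dots> \<le> L2_set (\<lambda>l. norm (Q (X l)) + C * norm x) {..<N}"
      using pointwise c by (intro L2_set_mono) auto
    also have "\<dots> \<le> L2_set (\<lambda>l. norm (Q (X l))) {..<N} + L2_set (\<lambda>l. C * norm x) {..<N}"
      by (rule L2_set_triangle_ineq)
    also have "\<dots> = N * norm (Q x) + sqrt N * (C * norm x)"
      unfolding QX L2 using C by (simp add: L2_set_def real_sqrt_mult)
    finally show ?thesis by (simp add: mult_ac)
  qed simp
  have bound: "c * norm x \<le> norm (Q x) + C * norm x / sqrt N" if "N > 0" for N :: nat
  proof -
    have "sqrt N * sqrt N = N" by simp
    hence "C * norm x / sqrt N * N = sqrt N * (C * norm x)"
      using that by (simp add: field_simps)
    hence "(c * norm x) * N \<le> (norm (Q x) + C * norm x / sqrt N) * N"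
      using main[of N] unfolding distrib_right by (simp only: mult_ac)
    thus ?thesis using that by simp
  qed
  have ev: "eventually (\<lambda>N::nat. c * norm x \<le> norm (Q x) + C * norm x / sqrt N) sequentially"
    using eventually_gt_at_top[of 0] by (rule eventually_mono) (rule bound)
  have "filterlim (\<lambda>N::nat. sqrt N) at_top sequentially"
    by (rule filterlim_compose[OF sqrt_at_top filterlim_real_sequentially])
  hence "(\<lambda>N::nat. norm (Q x) + C * norm x / sqrt N) \<longlonglongrightarrow> norm (Q x) + 0"
    by (intro tendsto_add tendsto_const real_tendsto_divide_at_top[where c = "C * norm x"])
  from tendsto_lowerbound[OF this ev] show ?thesis by (simp add: Q_def)
qed

section \<open>The method of continuity\<close>

text \<open>With a right inverse \<open>h\<close> of \<open>F\<close>, any fixed point of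
  \<open>x \<mapsto> h (y - (G - F) x)\<close> solves \<open>G x = y\<close>. The map is a
  contraction with constant \<open>norm (G - F) / m < 1\<close>.\<close>

lemma surj_perturbation:
  fixes F G :: "'a::banach \<Rightarrow>\<^sub>L 'a"
  assumes "surj (blinfun_apply F)" "\<And>x. m * norm x \<le> norm (F x)" "norm (G - F) < m"
  shows "surj (blinfun_apply G)"
proof -
  have m: "m > 0" using assms(3) norm_ge_zero[of "G - F"] by linarith
  have "\<exists>h. \<forall>y. F (h y) = y" using assms(1) unfolding surj_def by metis
  then obtain h where h: "\<And>y. F (h y) = y" by blast
  \<comment> \<open>\<open>h\<close> is an arbitrary choice of preimages and need not be linear; the
    estimate uses only the linearity of \<open>F\<close> and its lower bound at
    \<open>h u - h v\<close>.\<close>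
  have h_lip: "m * dist (h u) (h v) \<le> dist u v" for u v
    using assms(2)[of "h u - h v"] by (simp add: h blinfun.diff_right dist_norm)
  have "\<exists>x. G x = y" for y
  proof -
    let ?q = "norm (G - F) / m"
    have "dist (h (y - (G - F) u)) (h (y - (G - F) v)) \<le> ?q * dist u v" for u v
    proof -
      have "m * dist (h (y - (G - F) u)) (h (y - (G - F) v)) \<le> dist (y - (G - F) u) (y - (G - F) v)"
        by (rule h_lip)
      also have "\<dots> = norm ((G - F) (u - v))"
        by (simp add: dist_norm blinfun.diff_right norm_minus_commute)
      also have "\<dots> \<le> norm (G - F) * dist u v" unfolding dist_norm by (rule norm_blinfun)
      finally show ?thesis using m by (simp add: field_simps)
    qed
    then obtain x where "h (y - (G - F) x) = x"
      using banach_fix_type[of ?q "\<lambda>x. h (y - (G - F) x)"] m assms(3) by auto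
    hence "F x = y - (G - F) x" using h[of "y - (G - F) x"] by simp
    hence "G x = y" by (simp add: blinfun.diff_left)
    thus ?thesis ..
  qed
  thus ?thesis unfolding surj_def by metis
qed

text \<open>Because \<open>m\<close> does not depend on \<open>r\<close>, uniform continuity gives
  one step length along which surjectivity is always inherited. Finitely many steps lead from
  \<open>0\<close> to \<open>1\<close>.\<close>

lemma continuity_method:
  fixes F :: "real \<Rightarrow> 'a::banach \<Rightarrow>\<^sub>L 'a"
  assumes cont: "continuous_on {0..1} F" and m: "m > 0"
    and lower: "\<And>r x. 0 \<le> r \<Longrightarrow> r \<le> 1 \<Longrightarrow> m * norm x \<le> norm (F r x)"
    and surj: "surj (blinfun_apply (F 0))"
  shows "surj (blinfun_apply (F 1))"
proof -
  have "uniformly_continuous_on {0..1} F"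
    using cont by (rule compact_uniformly_continuous) simp
  then obtain \<delta> where \<delta>: "\<delta> > 0"
    "\<And>r s. r \<in> {0..1} \<Longrightarrow> s \<in> {0..1} \<Longrightarrow> dist s r < \<delta> \<Longrightarrow> dist (F s) (F r) < m"
    unfolding uniformly_continuous_on_def using m by metis
  obtain N where N: "inverse (real (Suc N)) < \<delta>" using reals_Archimedean[OF \<delta>(1)] by blast
  have "surj (blinfun_apply (F (real n / real (Suc N))))" if "n \<le> Suc N" for n
    using that
  proof (induction n)
    case (Suc n)
    let ?r = "real n / real (Suc N)" and ?s = "real (Suc n) / real (Suc N)"
    have rs: "?r \<in> {0..1}" "?s \<in> {0..1}" using Suc.prems by auto
    have "dist ?s ?r = inverse (real (Suc N))"
      unfolding dist_real_def diff_divide_distrib[symmetric] by (simp add: divide_inverse)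
    hence "norm (F ?s - F ?r) < m" using \<delta>(2)[OF rs] N by (simp add: dist_norm)
    moreover have "m * norm x \<le> norm (F ?r x)" for x using lower rs by simp
    moreover have "surj (blinfun_apply (F ?r))" using Suc by simp
    ultimately show ?case by (intro surj_perturbation[of "F ?r" m "F ?s"])
  qed (use surj in simp)
  from this[of "Suc N"] show ?thesis by simp
qed

section \<open>The perturbed operator\<close>

lemma has_sum_imp_tendsto_atLeastAtMost:
  fixes f :: "nat \<Rightarrow> 'a::{comm_monoid_add, topological_space}"
  assumes "(f has_sum S) {m..}"
  shows "(\<lambda>N. \<Sum>j=m..N. f j) \<longlonglongrightarrow> S"
proof -
  have "filterlim (\<lambda>N. {m..N}) (finite_subsets_at_top {m..}) sequentially"
    unfolding filterlim_finite_subsets_at_top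
  proof (intro allI impI)
    fix X assume X: "finite X \<and> X \<subseteq> {m..}"
    then obtain N where N: "X \<subseteq> {..N}" by (meson finite_nat_iff_bounded_le)
    show "\<forall>\<^sub>F n in sequentially. finite {m..n} \<and> X \<subseteq> {m..n} \<and> {m..n} \<subseteq> {m..}"
      using eventually_ge_at_top[of N] by (rule eventually_mono) (use X N in fastforce)
  qed
  thus ?thesis using assms unfolding has_sum_def by (rule filterlim_compose[rotated])
qed

text \<open>A polynomial in the scalar \<open>z\<close> with diagonal coefficients is again
  diagonal, and its entries are the values of the symbol; the entrywise bound then passes to norms
  by Parseval.\<close>

lemma diag_symbol_lower_bound:
  fixes e :: "nat \<Rightarrow> 'h::complex_hilbert" and \<alpha> :: "nat \<Rightarrow> nat \<Rightarrow> complex"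
  assumes basis: "orthonormal_basis e" and "finite I" "\<And>k. k \<in> I \<Longrightarrow> bounded_diag e (\<alpha> k)"
    and lower: "\<And>n. n \<ge> 1 \<Longrightarrow> c \<le> cmod (\<Sum>k\<in>I. \<alpha> k n * z ^ k)" and c: "c \<ge> 0"
  shows "c * norm x \<le> norm (\<Sum>k\<in>I. (z ^ k) *\<^sub>C diag e (\<alpha> k) x)"
proof -
  have "\<exists>K. \<forall>n\<ge>1. cmod (\<alpha> k n) \<le> K" if "k \<in> I" for k
    using bounded_diagE[OF basis assms(3)[OF that]] by metis
  then obtain K where K: "\<And>k. k \<in> I \<Longrightarrow> \<forall>n\<ge>1. cmod (\<alpha> k n) \<le> K k" by metis
  define s where "s n = (\<Sum>k\<in>I. \<alpha> k n * z ^ k)" for n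
  have s: "\<forall>n\<ge>1. cmod (s n) \<le> (\<Sum>k\<in>I. K k * cmod z ^ k)"
    unfolding s_def using K
    by (auto intro!: sum_norm_le mult_right_mono simp: norm_mult norm_power)
  have "(\<Sum>k\<in>I. (z ^ k) *\<^sub>C diag e (\<alpha> k) x) = diag e s x"
  proof (rule eq_if_coeffs_eq[OF basis])
    fix n :: nat assume n: "n \<ge> 1"
    show "cinner (\<Sum>k\<in>I. (z ^ k) *\<^sub>C diag e (\<alpha> k) x) (e n) = cinner (diag e s x) (e n)"
      unfolding cinner_diag[OF basis s n] cinner_sum_left cinner_scaleC_left s_def sum_distrib_right
      by (intro sum.cong refl) (simp add: cinner_diag[OF basis K n])
  qed
  moreover have "c * norm x \<le> norm (diag e s x)"
    by (rule norm_diag_ge[OF basis s _ c]) (use lower in \<open>simp add: s_def\<close>)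
  ultimately show ?thesis by simp
qed

text \<open>The hypothesis on the symbol concerns the open disc, whereas the spectral argument
  evaluates it on the unit circle. Continuity bridges the gap.\<close>

lemma le_on_closed_disc:
  fixes f :: "complex \<Rightarrow> complex"
  assumes "continuous_on UNIV f" "\<And>z. cmod z < 1 \<Longrightarrow> c \<le> cmod (f z)" "cmod z \<le> 1"
  shows "c \<le> cmod (f z)"
proof -
  have "closed {z. c \<le> cmod (f z)}"
    by (intro closed_Collect_le continuous_intros assms(1))
  hence "closure (ball 0 1) \<subseteq> {z. c \<le> cmod (f z)}"
    using assms(2) by (intro closure_minimal) auto
  thus ?thesis using assms(3) by (auto simp: closure_ball)
qed

theorem corollary2p3:
  fixes e :: "nat \<Rightarrow> 'h::complex_hilbert"
    and M :: "nat \<Rightarrow> 'h \<Rightarrow> 'h"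
    and d p :: nat
    and a b :: "nat \<Rightarrow> nat \<Rightarrow> complex"
    and T :: "'h \<Rightarrow> 'h"
  assumes basis: "orthonormal_basis e"
    and M_isometry: "\<And>j. j \<ge> 1 \<Longrightarrow> clinear_isometry (M j)"
    and M_basis: "\<And>j n. j \<ge> 1 \<Longrightarrow> n \<ge> 1 \<Longrightarrow> M j (e n) = e (n * j)"
    and d: "d \<ge> 1" and p: "p \<ge> 1"
    and A_bounded: "\<And>k. k \<in> {1..d} \<Longrightarrow> bounded_diag e (a k)"
    and a_periodic: "\<And>k n. k \<in> {1..d} \<Longrightarrow> n \<ge> 1 \<Longrightarrow> a k (p * n) = a k n"
    and small:
      "(\<Sum>\<^sub>\<infinity>j\<in>{2..}. SUP n\<in>{1..}. ennreal (cmod (b j n)))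
        < (INF z\<in>ball (0::complex) 1. INF n\<in>{1..}.
             ennreal (cmod (1 + (\<Sum>k=1..d. a k n * z ^ k))))"
    and T: "\<And>x. T x = x + (\<Sum>k=1..d. diag e (a k) ((M p ^^ k) x))
                        + (\<Sum>\<^sub>\<infinity>j\<in>{2..}. M j (diag e (b j) x))"
  shows "(\<forall>j\<ge>2. bounded_diag e (b j))
    \<and> (\<lambda>N. onorm (\<lambda>x. T x - (x + (\<Sum>k=1..d. diag e (a k) ((M p ^^ k) x))
                                + (\<Sum>j=2..N. M j (diag e (b j) x))))) \<longlonglongrightarrow> 0
    \<and> bounded_clinear T
    \<and> boundedly_invertible T"
proof -
  \<comment> \<open>In the extended nonnegative reals the suprema and their sum exist without prior
    boundedness. Finiteness is derived: \<open>c0\<close> is finite by evaluation at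
    \<open>z = 0\<close>, \<open>n = 1\<close>, and \<open>S0\<close> lies below it.\<close>
  define \<beta> where "\<beta> j = (SUP n\<in>{1..}. ennreal (cmod (b j n)))" for j
  define S0 where "S0 = (\<Sum>\<^sub>\<infinity>j\<in>{2..}. \<beta> j)"
  define c0 where "c0 = (INF z\<in>ball (0::complex) 1. INF n\<in>{1..}.
             ennreal (cmod (1 + (\<Sum>k=1..d. a k n * z ^ k))))"
  define S where "S = enn2real S0"
  define c where "c = enn2real c0"
  have S0c0: "S0 < c0" using small unfolding S0_def c0_def \<beta>_def .
  have c0_le: "c0 \<le> ennreal (cmod (1 + (\<Sum>k=1..d. a k n * z ^ k)))" if "cmod z < 1" "n \<ge> 1" for z n
    unfolding c0_def using that by (intro INF_lower2[of z] INF_lower2[of n]) auto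
  have "c0 \<le> ennreal (cmod (1 + (\<Sum>k=1..d. a k 1 * 0 ^ k)))" by (rule c0_le) auto
  also have "\<dots> < top" by simp
  finally have c0: "c0 = ennreal c" by (simp add: c_def)
  have "S0 < top" using S0c0 by (rule order.strict_trans2) simp
  hence S0: "S0 = ennreal S" by (simp add: S_def)
  have cS: "S < c" "0 \<le> S" "0 \<le> c"
    using S0c0 unfolding c0 S0 by (auto simp: S_def c_def ennreal_less_iff)
  have symbol: "c \<le> cmod (1 + (\<Sum>k=1..d. a k n * z ^ k))" if "cmod z \<le> 1" "n \<ge> 1" for z n
  proof (rule le_on_closed_disc[OF _ _ that(1)])
    show "c \<le> cmod (1 + (\<Sum>k=1..d. a k n * z ^ k))" if "cmod z < 1" for z
      using c0_le[OF that \<open>n \<ge> 1\<close>] unfolding c0 by simp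
  qed (intro continuous_intros)

  \<comment> \<open>Bounds on the entries of the operators \<open>B j\<close>\<close>
  have sum_\<beta>: "(\<Sum>j\<in>F. \<beta> j) \<le> S0" if "finite F" "F \<subseteq> {2..}" for F
    unfolding S0_def using that
    by (subst nonneg_infsum_complete) (auto intro: SUP_upper)
  have \<beta>_fin: "\<beta> j = ennreal (enn2real (\<beta> j))" if "j \<ge> 2" for j
  proof -
    have "\<beta> j \<le> S0" using sum_\<beta>[of "{j}"] that by simp
    also have "\<dots> < top" by (simp add: S0)
    finally show ?thesis by simp
  qed
  have sum_\<beta>': "(\<Sum>j\<in>F. enn2real (\<beta> j)) \<le> S" if "finite F" "F \<subseteq> {2..}" for F
  proof -
    have "ennreal (\<Sum>j\<in>F. enn2real (\<beta> j)) = (\<Sum>j\<in>F. ennreal (enn2real (\<beta> j)))"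
      by (simp add: sum_ennreal)
    also have "\<dots> = (\<Sum>j\<in>F. \<beta> j)" using \<beta>_fin that by (intro sum.cong) auto
    also have "\<dots> \<le> ennreal S" using sum_\<beta>[OF that] by (simp add: S0)
    finally show ?thesis using cS by (simp add: ennreal_le_iff)
  qed
  have b_le: "\<forall>n\<ge>1. cmod (b j n) \<le> enn2real (\<beta> j)" if "j \<ge> 2" for j
  proof (intro allI impI)
    fix n :: nat assume "n \<ge> 1"
    hence "ennreal (cmod (b j n)) \<le> \<beta> j" unfolding \<beta>_def by (intro SUP_upper) simp
    also have "\<dots> = ennreal (enn2real (\<beta> j))" by (rule \<beta>_fin[OF that])
    finally show "cmod (b j n) \<le> enn2real (\<beta> j)" by (simp add: ennreal_le_iff)
  qed
  have B_bounded: "bounded_diag e (b j)" if "j \<ge> 2" for j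
    by (rule bounded_diagI[OF basis b_le[OF that]])

  \<comment> \<open>Treating the summands as elements of the Banach space of bounded operators makes
    the series converge absolutely in operator norm, which later yields the norm limit of the
    partial sums.\<close>
  define W where "W j = Blinfun (\<lambda>x. M j (diag e (b j) x))" for j
  have MB: "bounded_clinear (\<lambda>x. M j (diag e (b j) x))" if "j \<ge> 2" for j
    by (rule bounded_clinear_compose[OF clinear_isometry_bounded_clinear[OF M_isometry]
          bounded_clinear_diag[OF basis b_le[OF that]]]) (use that in simp)
  have W_apply: "W j x = M j (diag e (b j) x)" if "j \<ge> 2" for j x
    unfolding W_def
    by (simp add: bounded_linear_Blinfun_apply[OF bounded_clinear_bounded_linear[OF MB[OF that]]])
  have W_norm: "norm (W j) \<le> enn2real (\<beta> j)" if "j \<ge> 2" for j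
  proof (rule norm_blinfun_bound)
    show "norm (W j x) \<le> enn2real (\<beta> j) * norm x" for x
      using norm_diag_le[OF basis b_le[OF that], of x] M_isometry[of j] that
      by (simp add: W_apply clinear_isometry_def)
  qed simp
  have W_sum: "(\<Sum>j\<in>F. norm (W j)) \<le> S" if "finite F" "F \<subseteq> {2..}" for F
  proof -
    have "(\<Sum>j\<in>F. norm (W j)) \<le> (\<Sum>j\<in>F. enn2real (\<beta> j))"
      using that W_norm by (intro sum_mono) auto
    thus ?thesis using sum_\<beta>'[OF that] by linarith
  qed
  have "W summable_on {2..}"
  proof (rule abs_summable_summable)
    show "(\<lambda>j. norm (W j)) summable_on {2..}"
      by (rule nonneg_bounded_partial_sums_imp_summable_on[where C = S])
         (auto intro!: eventually_finite_subsets_at_top_weakI W_sum)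
  qed
  then obtain R where R: "(W has_sum R) {2..}" unfolding summable_on_def by blast
  have R_lim: "(\<lambda>N. \<Sum>j=2..N. W j) \<longlonglongrightarrow> R"
    by (rule has_sum_imp_tendsto_atLeastAtMost[OF R])
  have R_norm: "norm R \<le> S"
  proof (rule Lim_norm_ubound[OF _ R_lim])
    show "\<forall>\<^sub>F N in sequentially. norm (\<Sum>j=2..N. W j) \<le> S"
    proof (rule always_eventually, rule allI)
      fix N
      have "norm (\<Sum>j=2..N. W j) \<le> (\<Sum>j=2..N. norm (W j))" by (rule norm_sum)
      also have "\<dots> \<le> S" by (rule W_sum) auto
      finally show "norm (\<Sum>j=2..N. W j) \<le> S" .
    qed
  qed simp
  \<comment> \<open>Evaluation at \<open>x\<close> is continuous, so the operator limit agrees with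
    the pointwise infinite sum occurring in \<open>T\<close>.\<close>
  have R_has_sum: "((\<lambda>j. M j (diag e (b j) x)) has_sum R x) {2..}" for x
  proof -
    have "((\<lambda>j. W j x) has_sum R x) {2..}"
      by (rule has_sum_bounded_linear[OF blinfun.bounded_linear_left R])
    moreover have "((\<lambda>j. W j x) has_sum R x) {2..} \<longleftrightarrow>
        ((\<lambda>j. M j (diag e (b j) x)) has_sum R x) {2..}"
      by (rule has_sum_cong) (simp add: W_apply)
    ultimately show ?thesis by simp
  qed
  \<comment> \<open>Elements of the operator space are only real linear, so complex homogeneity of
    \<open>R\<close> has to be recovered from its summands.\<close>
  have R_scaleC: "R (z *\<^sub>C x) = z *\<^sub>C R x" for z x
  proof (rule has_sum_unique[OF R_has_sum])
    have "((\<lambda>j. z *\<^sub>C M j (diag e (b j) x)) has_sum z *\<^sub>C R x) {2..}"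
      by (rule has_sum_bounded_linear[OF bounded_linear_scaleC R_has_sum])
    moreover have "((\<lambda>j. z *\<^sub>C M j (diag e (b j) x)) has_sum z *\<^sub>C R x) {2..} \<longleftrightarrow>
        ((\<lambda>j. M j (diag e (b j) (z *\<^sub>C x))) has_sum z *\<^sub>C R x) {2..}"
      by (rule has_sum_cong) (simp add: bounded_clinear_scaleC[OF MB])
    ultimately show "((\<lambda>j. M j (diag e (b j) (z *\<^sub>C x))) has_sum z *\<^sub>C R x) {2..}" by simp
  qed

  \<comment> \<open>The identity is absorbed as the term \<open>k = 0\<close>, being the diagonal
    operator with all entries \<open>1\<close>.\<close>
  define \<alpha> where "\<alpha> k = (if k = 0 then \<lambda>_. 1 else a k)" for k
  have diag_\<alpha>0: "diag e (\<alpha> 0) x = x" for x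
    unfolding \<alpha>_def diag_def using infsumI[OF basis_expansion[OF basis]] by simp
  have \<alpha>_bounded: "bounded_diag e (\<alpha> k)" if "k \<in> {0..d}" for k
  proof (cases "k = 0")
    case True
    show ?thesis by (rule bounded_diagI[OF basis, of _ 1]) (simp add: \<alpha>_def True)
  qed (use that A_bounded in \<open>simp add: \<alpha>_def\<close>)
  have \<alpha>_clinear: "bounded_clinear (diag e (\<alpha> k))" if "k \<in> {0..d}" for k
    using \<alpha>_bounded[OF that] unfolding bounded_diag_def by simp
  have \<alpha>_sum: "(\<Sum>k=0..d. \<alpha> k n * z ^ k) = 1 + (\<Sum>k=1..d. a k n * z ^ k)" for n z
    unfolding sum.atLeast_Suc_atMost[OF le0] by (auto simp: \<alpha>_def intro!: sum.cong)
  define V where "V = M p"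
  have V: "clinear_isometry V" unfolding V_def by (rule M_isometry[OF p])
  have Vb: "bounded_clinear V" by (rule clinear_isometry_bounded_clinear[OF V])
  \<comment> \<open>Both sides send \<open>e n\<close> to a multiple of \<open>e (n * p)\<close>,
    with factors \<open>\<alpha> k (n * p)\<close> and \<open>\<alpha> k n\<close>; periodicity
    makes these equal.\<close>
  have comm: "diag e (\<alpha> k) (V x) = V (diag e (\<alpha> k) x)" if k: "k \<in> {0..d}" for k x
  proof (rule bounded_clinear_eq_on_basis[OF basis, where f = "\<lambda>x. diag e (\<alpha> k) (V x)"
        and g = "\<lambda>x. V (diag e (\<alpha> k) x)"])
    show "bounded_clinear (\<lambda>x. diag e (\<alpha> k) (V x))"
      by (rule bounded_clinear_compose[OF \<alpha>_clinear[OF k] Vb])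
    show "bounded_clinear (\<lambda>x. V (diag e (\<alpha> k) x))"
      by (rule bounded_clinear_compose[OF Vb \<alpha>_clinear[OF k]])
    fix n :: nat assume n: "n \<ge> 1"
    have "\<alpha> k (n * p) = \<alpha> k n"
      using a_periodic[of k n] k n by (simp add: \<alpha>_def mult.commute)
    moreover have "n * p \<ge> 1" using n p by simp
    ultimately show "diag e (\<alpha> k) (V (e n)) = V (diag e (\<alpha> k) (e n))"
      using n p by (simp add: V_def[symmetric] diag_basis[OF basis] bounded_clinear_scaleC[OF Vb]
          M_basis[OF p n, folded V_def])
  qed
  define E where "E k = Blinfun (\<lambda>x. diag e (\<alpha> k) ((V ^^ k) x))" for k
  have E_clinear: "bounded_clinear (\<lambda>x. diag e (\<alpha> k) ((V ^^ k) x))" if "k \<in> {0..d}" for k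
    by (rule bounded_clinear_compose[OF \<alpha>_clinear[OF that] bounded_clinear_power[OF Vb]])
  have E_apply: "E k x = diag e (\<alpha> k) ((V ^^ k) x)" if "k \<in> {0..d}" for k x
    unfolding E_def
    by (simp add: bounded_linear_Blinfun_apply[OF bounded_clinear_bounded_linear[OF E_clinear[OF that]]])

  \<comment> \<open>A path from the identity at \<open>r = 0\<close> to \<open>T\<close> at
    \<open>r = 1\<close>. The weights \<open>r ^ k\<close> amount to replacing \<open>z\<close> by
    \<open>r * z\<close> in the symbol, which keeps the argument in the closed disc.\<close>
  define F where "F r = (\<Sum>k=0..d. r ^ k *\<^sub>R E k) + r *\<^sub>R R" for r :: real
  have F_apply: "F r x = (\<Sum>k=0..d. r ^ k *\<^sub>R diag e (\<alpha> k) ((V ^^ k) x)) + r *\<^sub>R R x" for r x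
    unfolding F_def by (simp add: blinfun.add_left blinfun.sum_left blinfun.scaleR_left E_apply)
  have F1_apply: "F 1 x = x + (\<Sum>k=1..d. diag e (a k) ((M p ^^ k) x)) + R x" for x
  proof -
    have "(\<Sum>k=0..d. diag e (\<alpha> k) ((V ^^ k) x)) = x + (\<Sum>k=1..d. diag e (a k) ((M p ^^ k) x))"
      unfolding sum.atLeast_Suc_atMost[OF le0]
      by (auto simp: diag_\<alpha>0 V_def) (auto simp: \<alpha>_def intro!: sum.cong)
    thus ?thesis by (simp add: F_apply)
  qed
  have F1: "F 1 x = T x" for x
    unfolding F1_apply T infsumI[OF R_has_sum] ..
  \<comment> \<open>The unperturbed part is bounded below by \<open>c\<close>, and the perturbation
    \<open>r *\<^sub>R R\<close> removes at most \<open>S\<close>, uniformly in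
    \<open>r\<close>.\<close>
  have lower: "(c - S) * norm x \<le> norm (F r x)" if r: "0 \<le> r" "r \<le> 1" for r x
  proof -
    have "c * norm x \<le> norm (\<Sum>k=0..d. r ^ k *\<^sub>R diag e (\<alpha> k) ((V ^^ k) x))"
    proof (rule isometry_polynomial_lower_bound[OF V])
      fix k assume k: "k \<in> {0..d}"
      show "bounded_clinear (\<lambda>x. r ^ k *\<^sub>R diag e (\<alpha> k) x)"
        by (rule bounded_clinear_scaleR[OF \<alpha>_clinear[OF k]])
      show "r ^ k *\<^sub>R diag e (\<alpha> k) (V x) = V (r ^ k *\<^sub>R diag e (\<alpha> k) x)" for x
        by (simp add: comm[OF k] linear_simps(5)[OF bounded_clinear_bounded_linear[OF Vb]])
    next
      fix \<omega> x assume \<omega>: "cmod \<omega> = 1"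
      have "c * norm x \<le> norm (\<Sum>k=0..d. ((\<omega> * of_real r) ^ k) *\<^sub>C diag e (\<alpha> k) x)"
      proof (rule diag_symbol_lower_bound[OF basis _ \<alpha>_bounded])
        show "c \<le> cmod (\<Sum>k=0..d. \<alpha> k n * (\<omega> * of_real r) ^ k)" if "n \<ge> 1" for n
          unfolding \<alpha>_sum using \<omega> r that by (intro symbol) (auto simp: norm_mult)
      qed (use cS in auto)
      also have "(\<Sum>k=0..d. ((\<omega> * of_real r) ^ k) *\<^sub>C diag e (\<alpha> k) x) =
          (\<Sum>k=0..d. (\<omega> ^ k) *\<^sub>C r ^ k *\<^sub>R diag e (\<alpha> k) x)"
        by (intro sum.cong refl)
           (simp add: power_mult_distrib scaleC_scaleC[symmetric] scaleC_of_real
             flip: of_real_power)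
      finally show "c * norm x \<le> norm (\<Sum>k=0..d. (\<omega> ^ k) *\<^sub>C r ^ k *\<^sub>R diag e (\<alpha> k) x)" .
    qed (use cS in auto)
    moreover have "norm (r *\<^sub>R R x) \<le> S * norm x"
    proof -
      have "norm (r *\<^sub>R R x) \<le> 1 * norm (R x)" using r by (simp add: mult_left_le_one_le)
      also have "\<dots> \<le> norm R * norm x" using norm_blinfun[of R x] by simp
      also have "\<dots> \<le> S * norm x" using R_norm by (rule mult_right_mono) simp
      finally show ?thesis .
    qed
    moreover have "norm (\<Sum>k=0..d. r ^ k *\<^sub>R diag e (\<alpha> k) ((V ^^ k) x)) \<le>
        norm (F r x) + norm (r *\<^sub>R R x)"
      unfolding F_apply using norm_triangle_ineq4[of "F r x" "r *\<^sub>R R x"] by (simp add: F_apply)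
    ultimately show ?thesis by (simp add: left_diff_distrib)
  qed
  have "surj (blinfun_apply (F 1))"
  proof (rule continuity_method)
    show "continuous_on {0..1} F" unfolding F_def by (intro continuous_intros)
    \<comment> \<open>The convention \<open>0 ^ 0 = 1\<close> retains exactly the term
      \<open>k = 0\<close>, which is the identity.\<close>
    have "F 0 x = x" for x
      unfolding F_apply sum.atLeast_Suc_atMost[OF le0] by (auto simp: diag_\<alpha>0 intro!: sum.neutral)
    thus "surj (blinfun_apply (F 0))" unfolding surj_def by metis
    show "0 < c - S" using cS by simp
  qed (rule lower)
  hence surj: "surj T" using F1 by (simp add: surj_def)
  have T_clinear: "bounded_clinear T"
  proof (rule bounded_clinearI)
    show "T (x + y) = T x + T y" for x y by (simp add: F1[symmetric] blinfun.add_right)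
    show "norm (T x) \<le> norm (F 1) * norm x" for x by (simp add: F1[symmetric] norm_blinfun)
    show "T (z *\<^sub>C x) = z *\<^sub>C T x" for z x
    proof -
      have "(\<Sum>k=0..d. diag e (\<alpha> k) ((V ^^ k) (z *\<^sub>C x))) =
          z *\<^sub>C (\<Sum>k=0..d. diag e (\<alpha> k) ((V ^^ k) x))"
        unfolding complex_vector.scale_sum_right
        by (intro sum.cong refl) (rule bounded_clinear_scaleC[OF E_clinear])
      thus ?thesis by (simp add: F1[symmetric] F_apply R_scaleC scaleC_add_right)
    qed
  qed
  have "boundedly_invertible T"
    by (rule boundedly_invertibleI[OF T_clinear surj, where m = "c - S"])
       (use cS lower[of 1] in \<open>simp_all add: F1\<close>)
  moreover have "(\<lambda>N. onorm (\<lambda>x. T x - (x + (\<Sum>k=1..d. diag e (a k) ((M p ^^ k) x))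
                                + (\<Sum>j=2..N. M j (diag e (b j) x))))) \<longlonglongrightarrow> 0"
  proof -
    \<comment> \<open>The polynomial part cancels, leaving the tail of the operator series; its
      \<open>onorm\<close> is the norm in the operator space, where convergence is already
      known.\<close>
    have eq: "T x - (x + (\<Sum>k=1..d. diag e (a k) ((M p ^^ k) x)) + (\<Sum>j=2..N. M j (diag e (b j) x)))
        = (R - (\<Sum>j=2..N. W j)) x" for x N
      unfolding F1[symmetric] F1_apply
      by (simp add: blinfun.diff_left blinfun.sum_left W_apply)
    have "(\<lambda>N. norm (R - (\<Sum>j=2..N. W j))) \<longlonglongrightarrow> norm (R - R)"
      by (intro tendsto_intros R_lim)
    hence "(\<lambda>N. norm (R - (\<Sum>j=2..N. W j))) \<longlonglongrightarrow> 0" by simp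
    thus ?thesis unfolding eq norm_blinfun.rep_eq .
  qed
  ultimately show ?thesis using B_bounded T_clinear by blast
qed

end
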